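(* Let $G$ be an amenable topological group and let $d$ be a continuous left-invariant écart on $G$. Assume that either $d$ is bounded or that $G$ has no non-trivial continuous homomorphisms to $\mathbb{R}$. Then, for every finite subset $E\subseteq G$, $$\inf_{\beta\in\Delta G}\ \max_{g,f\in E}\ \|\beta g-\beta f\|_{\mathrm{AE}}=0.$$
   Context: A topological group $G$ is amenable if every continuous affine action of $G$ on a non-empty compact convex subset of a locally convex topological vector space has a fixed point. Equivalently, there is a mean $\mathfrak m$ (positive linear functional of norm $1$ with $\mathfrak m(\mathbf 1)=1$) on the algebra $\mathsf{LUCB}(G)$ of bounded functions $\phi:G\to\mathbb R$ for which $g\mapsto\phi(\,\cdot\,g)$ is continuous in the sup norm, such that $\mathfrak m(\phi(\,\cdot\, g))=\mathfrak m(\phi)$ for all $g\in G$. An écart (pseudometric) is like a metric except that $d(x,y)=0$ is allowed for $x\neq y$. $\mathbb{R}G$ denotes the real group algebra of $G$ (finite formal linear combinations of elements of $G$, with product extending that of $G$ bilinearly), and $\Delta G$ is the convex hull of $G$ in $\mathbb{R}G$, i.e., the set of finite convex combinations $\sum_i\lambda_i g_i$. For $\alpha,\beta\in\Delta G$, $$\|\alpha-\beta\|_{\mathrm{AE}}=\inf\Big\{\sum_{i=1}^n|a_i|\,d(g_i,f_i)\ \Big|\ \alpha-\beta=\sum_{i=1}^n a_i(g_i-f_i),\ a_i\in\mathbb{R},\ g_i,f_i\in G\Big\}.$$ *)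

theory Defs
  imports "HOL-Analysis.Analysis" "HOL-Analysis.Finite_Function_Topology"
begin

text \<open>
  The group \<open>G\<close> is the type \<open>'a :: topological_group_add\<close>. In spite of the additive notation this
  class contains all topological groups: \<^class>\<open>group_add\<close> does not assume commutativity, and the
  topology need not be Hausdorff. So \<open>x + g\<close> stands for the product \<open>xg\<close>, \<open>0\<close> for the identity.
  With this notation the library's convolution product makes \<open>'a \<Rightarrow>\<^sub>0 real\<close> the real group algebra.
\<close>

text \<open>
  The second condition says that the map from \<open>g\<close> to the right translate of \<open>\<phi>\<close> by \<open>g\<close> is
  continuous at every \<open>g\<close> for the sup norm.
\<close>

definition LUCB :: "('a::topological_group_add \<Rightarrow> real) set" where
  "LUCB = {\<phi>. bounded (range \<phi>) \<and>
              (\<forall>g. uniform_limit UNIV (\<lambda>h x. \<phi> (x + h)) (\<lambda>x. \<phi> (x + g)) (at g))}"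

text \<open>
  A functional on \<^const>\<open>LUCB\<close> is represented by a function on all of \<open>'a \<Rightarrow> real\<close>, whose values
  outside \<^const>\<open>LUCB\<close> are irrelevant. Its operator norm (possibly infinite) is the supremum over the
  unit ball.
\<close>

definition LUCB_norm :: "(('a::topological_group_add \<Rightarrow> real) \<Rightarrow> real) \<Rightarrow> ereal" where
  "LUCB_norm m = (SUP \<phi>\<in>{\<phi>\<in>LUCB. \<forall>x. \<bar>\<phi> x\<bar> \<le> 1}. ereal \<bar>m \<phi>\<bar>)"

definition mean_on_LUCB :: "(('a::topological_group_add \<Rightarrow> real) \<Rightarrow> real) \<Rightarrow> bool" where
  "mean_on_LUCB m \<longleftrightarrow>
     (\<forall>\<phi>\<in>LUCB. \<forall>\<psi>\<in>LUCB. m (\<lambda>x. \<phi> x + \<psi> x) = m \<phi> + m \<psi>) \<and>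
     (\<forall>\<phi>\<in>LUCB. \<forall>c. m (\<lambda>x. c * \<phi> x) = c * m \<phi>) \<and>
     (\<forall>\<phi>\<in>LUCB. (\<forall>x. 0 \<le> \<phi> x) \<longrightarrow> 0 \<le> m \<phi>) \<and>
     LUCB_norm m = 1 \<and>
     m (\<lambda>x. 1) = 1"

text \<open>
  Amenability in the form of the invariant mean criterion; the fixed point definition quantifies over
  all locally convex spaces, hence over types, which is not possible inside a HOL formula.
\<close>

definition amenable :: "'a::topological_group_add itself \<Rightarrow> bool" where
  "amenable _ \<longleftrightarrow>
     (\<exists>m :: ('a \<Rightarrow> real) \<Rightarrow> real. mean_on_LUCB m \<and>
        (\<forall>g. \<forall>\<phi>\<in>LUCB. m (\<lambda>x. \<phi> (x + g)) = m \<phi>))"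

definition ecart :: "('a \<Rightarrow> 'a \<Rightarrow> real) \<Rightarrow> bool" where
  "ecart d \<longleftrightarrow>
     (\<forall>x y. 0 \<le> d x y) \<and> (\<forall>x. d x x = 0) \<and> (\<forall>x y. d x y = d y x) \<and>
     (\<forall>x y z. d x z \<le> d x y + d y z)"

definition left_invariant :: "('a::plus \<Rightarrow> 'a \<Rightarrow> real) \<Rightarrow> bool" where
  "left_invariant d \<longleftrightarrow> (\<forall>g x y. d (g + x) (g + y) = d x y)"

definition of_group :: "'a \<Rightarrow> ('a \<Rightarrow>\<^sub>0 real)" where
  "of_group g = Poly_Mapping.single g 1"

definition Delta :: "('a \<Rightarrow>\<^sub>0 real) set" where
  "Delta = convex hull (range of_group)"

text \<open>
  The norm is a function of the difference \<open>\<gamma> = \<alpha> - \<beta>\<close> only. When \<open>\<alpha>\<close> and \<open>\<beta>\<close> lie in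
  \<^const>\<open>Delta\<close>, the set below is non-empty (and bounded below by 0 for an ecart \<open>d\<close>).
\<close>

definition AE_norm :: "('a \<Rightarrow> 'a \<Rightarrow> real) \<Rightarrow> ('a \<Rightarrow>\<^sub>0 real) \<Rightarrow> real" where
  "AE_norm d \<gamma> =
     Inf {\<Sum>i<n. \<bar>a i\<bar> * d (g i) (f i) | (n::nat) (a :: nat \<Rightarrow> real) (g :: nat \<Rightarrow> 'a) (f :: nat \<Rightarrow> 'a).
            \<gamma> = (\<Sum>i<n. a i *\<^sub>R (of_group (g i) - of_group (f i)))}"

text \<open>
  Inserting 0 only serves to fix the value 0 for empty \<open>E\<close>: otherwise 0 is already present, as the
  term with \<open>g = f\<close>.
\<close>

definition max_displacement ::
  "('a::monoid_add \<Rightarrow> 'a \<Rightarrow> real) \<Rightarrow> 'a set \<Rightarrow> ('a \<Rightarrow>\<^sub>0 real) \<Rightarrow> real" where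
  "max_displacement d E \<beta> =
     Max (insert 0 {AE_norm d (\<beta> * of_group g - \<beta> * of_group f) | g f. g \<in> E \<and> f \<in> E})"

end

theory Submission
  imports Defs
begin

text \<open>
  Suppose the infimum is positive. The tuples \<open>(\<beta>g - \<beta>)\<^sub>g\<close>, indexed by \<open>g \<in> E\<close>, with \<open>\<beta> \<in> \<Delta>G\<close>, form a
  convex set bounded away from 0 in the sum of the AE seminorms, so by Hahn-Banach some linear functional
  dominated by this seminorm is at least a constant \<open>c > 0\<close> on it. Its components restrict to 1-Lipschitz
  functions \<open>\<phi>\<^sub>g\<close> on \<open>G\<close> with \<open>\<Sum>\<^sub>g (\<phi>\<^sub>g(xg) - \<phi>\<^sub>g(x)) \<ge> c\<close> for all \<open>x\<close>. For a Lipschitz function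
  \<open>\<phi>\<close>, left invariance of \<open>d\<close> makes \<open>x \<mapsto> \<phi>(xu) - \<phi>(x)\<close> bounded and uniformly continuous, and its
  invariant mean is a continuous homomorphism in \<open>u\<close>, bounded by \<open>d(u, 1)\<close>. Under either assumption it
  vanishes, which contradicts the lower bound \<open>c\<close>.
\<close>

section \<open>Hahn-Banach separation for sublinear functionals\<close>

definition sublinear :: "('v::real_vector \<Rightarrow> real) \<Rightarrow> bool" where
  "sublinear q \<longleftrightarrow> (\<forall>x y. q (x + y) \<le> q x + q y) \<and> (\<forall>t\<ge>0. \<forall>x. q (t *\<^sub>R x) = t * q x)"

lemma sublinear_add: "sublinear q \<Longrightarrow> q (x + y) \<le> q x + q y"
  by (simp add: sublinear_def)

lemma sublinear_scale: "sublinear q \<Longrightarrow> 0 \<le> t \<Longrightarrow> q (t *\<^sub>R x) = t * q x"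
  by (simp add: sublinear_def)

lemma sublinear_zero: "sublinear q \<Longrightarrow> q 0 = 0"
  using sublinear_scale[of q 0 0] by simp

lemma sublinear_minus: "sublinear q \<Longrightarrow> - q (- x) \<le> q x"
  using sublinear_add[of q x "- x"] sublinear_zero[of q] by simp

text \<open>For functionals defined by infima only one inequality for scaling is easy to check. The
  reverse one follows by applying it to the factor \<open>inverse t\<close>, and
  \<open>t = 1/2\<close> at the origin forces \<open>q 0 \<le> 0\<close>.\<close>

lemma sublinearI:
  assumes "\<And>x y. q (x + y) \<le> q x + q y" "0 \<le> q 0"
    and le: "\<And>t x. 0 < t \<Longrightarrow> q (t *\<^sub>R x) \<le> t * q x"
  shows "sublinear q"
proof -
  have zero: "q 0 = 0"
    using le[of "1/2" 0] assms(2) by simp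
  have "q (t *\<^sub>R x) = t * q x" if "0 \<le> t" for t x
  proof (cases "t = 0")
    case False
    then have t: "0 < t" using that by simp
    have "q x \<le> inverse t * q (t *\<^sub>R x)"
      using le[of "inverse t" "t *\<^sub>R x"] t by simp
    then have "t * q x \<le> q (t *\<^sub>R x)"
      using t by (simp add: field_simps)
    with le[OF t] show ?thesis by (simp add: antisym)
  qed (simp add: zero)
  with assms(1) show ?thesis by (simp add: sublinear_def)
qed

lemma le_cInf_add:
  fixes c :: real
  assumes "A \<noteq> {}" "B \<noteq> {}" "\<And>a b. a \<in> A \<Longrightarrow> b \<in> B \<Longrightarrow> c \<le> a + b"
  shows "c \<le> Inf A + Inf B"
proof -
  have "c - b \<le> Inf A" if "b \<in> B" for b
    using assms that by (intro cInf_greatest) (auto simp: algebra_simps)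
  then have "c - Inf A \<le> Inf B"
    using assms(2) by (intro cInf_greatest) (auto simp: algebra_simps)
  then show ?thesis by simp
qed

lemma le_mult_cInf:
  fixes c :: real
  assumes "A \<noteq> {}" "0 < t" "\<And>a. a \<in> A \<Longrightarrow> c \<le> t * a"
  shows "c \<le> t * Inf A"
proof -
  have "c / t \<le> Inf A"
    using assms by (intro cInf_greatest) (auto simp: field_simps)
  then show ?thesis using assms(2) by (simp add: field_simps)
qed

text \<open>
  The new functional is the largest sublinear one below \<open>p\<close> with \<open>q (- c) \<le> - \<epsilon>\<close> on \<open>C\<close>. Applied to
  \<open>C = {v}\<close> and \<open>\<epsilon> = p v\<close>, the lemma also shows that minimal sublinear functionals are odd, hence linear.
\<close>

lemma sublinear_below_on_convex:
  assumes p: "sublinear p" and C: "convex C" "C \<noteq> {}" and ge: "\<And>c. c \<in> C \<Longrightarrow> \<epsilon> \<le> p c"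
  shows "\<exists>q. sublinear q \<and> (\<forall>x. q x \<le> p x) \<and> (\<forall>c\<in>C. q (- c) \<le> - \<epsilon>)"
proof -
  define A where "A w = {p (w + t *\<^sub>R c) - t * \<epsilon> | t c. 0 \<le> t \<and> c \<in> C}" for w
  define q where "q w = Inf (A w)" for w
  have AI: "p (w + t *\<^sub>R c) - t * \<epsilon> \<in> A w" if "0 \<le> t" "c \<in> C" for w t c
    using that by (auto simp: A_def)
  have ne: "A w \<noteq> {}" for w
    using AI[of 0] C(2) by blast
  \<comment> \<open>A lower bound independent of \<open>t\<close> and \<open>c\<close>: adding
    \<open>- w\<close> cancels \<open>w\<close> and leaves \<open>p (t *\<^sub>R c)\<close>, which
    is at least \<open>t * \<epsilon>\<close>. So the infimum \<open>q w\<close> is finite.\<close>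
  have low: "- p (- w) \<le> a" if a_in: "a \<in> A w" for a w
  proof -
    obtain t c where a: "a = p (w + t *\<^sub>R c) - t * \<epsilon>" "0 \<le> t" "c \<in> C"
      using a_in by (auto simp: A_def)
    have "t * \<epsilon> \<le> p (t *\<^sub>R c)"
      using a ge by (simp add: sublinear_scale[OF p] mult_left_mono)
    also have "\<dots> \<le> p (w + t *\<^sub>R c) + p (- w)"
      using sublinear_add[OF p, of "w + t *\<^sub>R c" "- w"] by simp
    finally show ?thesis using a by simp
  qed
  have le: "q w \<le> a" if "a \<in> A w" for a w
    unfolding q_def using that low by (intro cInf_lower bdd_belowI) auto
  have q: "sublinear q"
  proof (rule sublinearI)
    show "0 \<le> q 0"
      unfolding q_def using low[of _ 0] ne by (intro cInf_greatest) (auto simp: sublinear_zero[OF p])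
    fix x y :: 'a
    show "q (x + y) \<le> q x + q y"
      unfolding q_def[of x] q_def[of y]
    proof (rule le_cInf_add[OF ne ne])
      fix a b assume "a \<in> A x" "b \<in> A y"
      then obtain s c t c' where
        s: "a = p (x + s *\<^sub>R c) - s * \<epsilon>" "0 \<le> s" "c \<in> C" and
        t: "b = p (y + t *\<^sub>R c') - t * \<epsilon>" "0 \<le> t" "c' \<in> C"
        by (auto simp: A_def)
      \<comment> \<open>Convexity enters here: the weighted average \<open>e\<close> of
        \<open>c\<close> and \<open>c'\<close> merges the two shifts into a single one of weight
        \<open>s + t\<close>. If both weights vanish, any point of \<open>C\<close> will do.\<close>
      obtain e where e: "e \<in> C" "(s + t) *\<^sub>R e = s *\<^sub>R c + t *\<^sub>R c'"
      proof (cases "s + t = 0")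
        case True
        then have "s = 0" "t = 0" using s t by auto
        with that[of c] s show ?thesis by simp
      next
        case False
        define e where "e = (s / (s + t)) *\<^sub>R c + (t / (s + t)) *\<^sub>R c'"
        have "e \<in> C"
          unfolding e_def using s t False
          by (intro convexD[OF C(1)]) (auto simp: add_divide_distrib[symmetric])
        moreover have "(s + t) *\<^sub>R e = s *\<^sub>R c + t *\<^sub>R c'"
          using False by (simp add: e_def scaleR_add_right)
        ultimately show ?thesis using that by blast
      qed
      have "q (x + y) \<le> p (x + y + (s + t) *\<^sub>R e) - (s + t) * \<epsilon>"
        using s t e by (intro le AI) auto
      also have "x + y + (s + t) *\<^sub>R e = (x + s *\<^sub>R c) + (y + t *\<^sub>R c')"
        unfolding e(2) by (simp add: algebra_simps)
      also have "p \<dots> \<le> p (x + s *\<^sub>R c) + p (y + t *\<^sub>R c')"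
        by (rule sublinear_add[OF p])
      finally show "q (x + y) \<le> a + b"
        by (simp add: s t algebra_simps)
    qed
  next
    fix r :: real and x :: 'a
    assume r: "0 < r"
    show "q (r *\<^sub>R x) \<le> r * q x"
      unfolding q_def[of x]
    proof (rule le_mult_cInf[OF ne r])
      fix a assume "a \<in> A x"
      then obtain t c where a: "a = p (x + t *\<^sub>R c) - t * \<epsilon>" "0 \<le> t" "c \<in> C"
        by (auto simp: A_def)
      have "q (r *\<^sub>R x) \<le> p (r *\<^sub>R x + (r * t) *\<^sub>R c) - (r * t) * \<epsilon>"
        using a r by (intro le AI) auto
      also have "r *\<^sub>R x + (r * t) *\<^sub>R c = r *\<^sub>R (x + t *\<^sub>R c)"
        by (simp add: algebra_simps)
      finally show "q (r *\<^sub>R x) \<le> r * a"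
        using r sublinear_scale[OF p, of r "x + t *\<^sub>R c"] by (simp add: a right_diff_distrib)
    qed
  qed
  moreover have "q x \<le> p x" for x
    using C(2) le[OF AI[of 0 _ x]] by auto
  moreover have "q (- c) \<le> - \<epsilon>" if "c \<in> C" for c
    using le[OF AI[of 1 c "- c"]] that by (simp add: sublinear_zero[OF p])
  ultimately show ?thesis by blast
qed

text \<open>Zorn's lemma for the reversed order. A non-empty chain has its pointwise infimum as
  lower bound, and this is finite because each \<open>a \<le> p\<close> satisfies
  \<open>- p (- w) \<le> - a (- w) \<le> a w\<close>.\<close>

lemma minimal_sublinear_exists:
  assumes p: "sublinear p"
  shows "\<exists>q. sublinear q \<and> q \<le> p \<and> (\<forall>r. sublinear r \<longrightarrow> r \<le> q \<longrightarrow> r = q)"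
proof -
  define S where "S = {q. sublinear q \<and> q \<le> p}"
  have "\<exists>m\<in>S. \<forall>a\<in>S. a \<le> m \<longrightarrow> a = m"
  proof (rule predicate_Zorn[where P = "\<lambda>a b. b \<le> a"])
    show "partial_order_on S (relation_of (\<lambda>a b. b \<le> a) S)"
      by (rule partial_order_on_relation_ofI) auto
    fix K assume K: "K \<in> Chains (relation_of (\<lambda>a b. b \<le> a) S)"
    then have KS: "K \<subseteq> S" and tot: "\<And>a b. a \<in> K \<Longrightarrow> b \<in> K \<Longrightarrow> a \<le> b \<or> b \<le> a"
      by (auto simp: Chains_def relation_of_def)
    show "\<exists>u\<in>S. \<forall>a\<in>K. u \<le> a"
    proof (cases "K = {}")
      case True
      then show ?thesis using p by (auto simp: S_def)
    next
      case False
      have sub: "sublinear a" if "a \<in> K" for a using that KS by (auto simp: S_def)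
      define u where "u w = (INF a\<in>K. a w)" for w
      have low: "- p (- w) \<le> a w" if "a \<in> K" for a w
      proof -
        have "a (- w) \<le> p (- w)" using that KS by (auto simp: S_def le_fun_def)
        then show ?thesis using sublinear_minus[OF sub[OF that], of w] by simp
      qed
      have le: "u w \<le> a w" if "a \<in> K" for a w
        unfolding u_def using that low by (intro cINF_lower bdd_belowI2) auto
      have "sublinear u"
      proof (rule sublinearI)
        show "0 \<le> u 0"
          unfolding u_def using False sub by (intro cINF_greatest) (auto simp: sublinear_zero)
        fix x y
        show "u (x + y) \<le> u x + u y"
          unfolding u_def[of x] u_def[of y]
        proof (rule le_cInf_add)
          fix a' b' assume "a' \<in> (\<lambda>a. a x) ` K" "b' \<in> (\<lambda>a. a y) ` K"
          then obtain a b where ab: "a \<in> K" "b \<in> K" "a' = a x" "b' = b y" by auto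
          \<comment> \<open>The smaller of \<open>a\<close> and \<open>b\<close> lies below both, so
            the values at \<open>x\<close> and \<open>y\<close> are estimated by one and the same
            sublinear functional.\<close>
          obtain c where c: "c \<in> K" "c \<le> a" "c \<le> b"
            using tot[OF ab(1,2)] ab by blast
          have "u (x + y) \<le> c x + c y"
            using le[OF c(1), of "x + y"] sublinear_add[OF sub[OF c(1)], of x y] by simp
          then show "u (x + y) \<le> a' + b'"
            using c(2,3) unfolding ab le_fun_def by (smt (verit))
        qed (use False in auto)
      next
        fix t :: real and x assume t: "0 < t"
        show "u (t *\<^sub>R x) \<le> t * u x"
          unfolding u_def[of x]
        proof (rule le_mult_cInf[OF _ t])
          fix a' assume "a' \<in> (\<lambda>a. a x) ` K"
          then obtain a where a: "a \<in> K" "a' = a x" by auto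
          then show "u (t *\<^sub>R x) \<le> t * a'"
            using le[OF a(1), of "t *\<^sub>R x"] sublinear_scale[OF sub[OF a(1)], of t x] t by simp
        qed (use False in auto)
      qed
      moreover have "u \<le> p"
      proof -
        obtain a where "a \<in> K" using False by blast
        moreover have "a \<le> p" using KS \<open>a \<in> K\<close> by (auto simp: S_def)
        ultimately show ?thesis using le[OF \<open>a \<in> K\<close>] by (auto simp: le_fun_def intro: order_trans)
      qed
      ultimately show ?thesis using le by (auto simp: S_def le_fun_def)
    qed
  qed
  then obtain m where m: "m \<in> S" "\<And>a. a \<in> S \<Longrightarrow> a \<le> m \<Longrightarrow> a = m" by blast
  then have "\<forall>r. sublinear r \<longrightarrow> r \<le> m \<longrightarrow> r = m"
    unfolding S_def by (metis (mono_tags, lifting) mem_Collect_eq order_trans)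
  with m(1) show ?thesis by (auto simp: S_def)
qed

lemma minimal_sublinear_linear:
  assumes q: "sublinear q" and min: "\<And>r. sublinear r \<Longrightarrow> r \<le> q \<Longrightarrow> r = q"
  shows "linear q"
proof -
  have neg: "q (- v) = - q v" for v
  proof -
    obtain r where "sublinear r" "\<forall>x. r x \<le> q x" "r (- v) \<le> - q v"
      using sublinear_below_on_convex[OF q, of "{v}" "q v"] by auto
    then have "q (- v) \<le> - q v" using min[of r] by (simp add: le_fun_def)
    with sublinear_minus[OF q, of v] show ?thesis by linarith
  qed
  show ?thesis
  proof (rule linearI)
    fix x y
    \<comment> \<open>Oddness turns subadditivity at \<open>- x\<close> and \<open>- y\<close> into
      superadditivity at \<open>x\<close> and \<open>y\<close>.\<close>
    show "q (x + y) = q x + q y"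
      using sublinear_add[OF q, of x y] sublinear_add[OF q, of "- x" "- y"] neg[of "x + y"]
      by (simp add: neg)
    fix t :: real
    show "q (t *\<^sub>R x) = t *\<^sub>R q x"
    proof (cases "0 \<le> t")
      case False
      then have "q ((- t) *\<^sub>R x) = (- t) * q x" by (intro sublinear_scale[OF q]) simp
      then show ?thesis by (simp add: neg)
    qed (simp add: sublinear_scale[OF q])
  qed
qed

text \<open>First push \<open>p\<close> down to a sublinear \<open>q\<close> with
  \<open>q (- c) \<le> - \<epsilon>\<close> on \<open>C\<close>, then pass to a minimal functional
  below \<open>q\<close>. This one is linear, so its upper bound at \<open>- c\<close> becomes the
  desired lower bound at \<open>c\<close>.\<close>

lemma Hahn_Banach_separation:
  assumes "sublinear p" "convex C" "C \<noteq> {}" "\<And>c. c \<in> C \<Longrightarrow> \<epsilon> \<le> p c"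
  shows "\<exists>f. linear f \<and> (\<forall>x. f x \<le> p x) \<and> (\<forall>c\<in>C. \<epsilon> \<le> f c)"
proof -
  obtain q where q: "sublinear q" "\<And>x. q x \<le> p x" "\<And>c. c \<in> C \<Longrightarrow> q (- c) \<le> - \<epsilon>"
    using sublinear_below_on_convex[OF assms] by blast
  obtain f where f: "sublinear f" "f \<le> q" "\<And>r. sublinear r \<Longrightarrow> r \<le> f \<Longrightarrow> r = f"
    using minimal_sublinear_exists[OF q(1)] by blast
  have "linear f" using minimal_sublinear_linear f by blast
  moreover have "f x \<le> p x" for x using f(2) q(2) by (meson le_funD order_trans)
  moreover have "\<epsilon> \<le> f c" if "c \<in> C" for c
  proof -
    have "f (- c) \<le> - \<epsilon>" using f(2) q(3)[OF that] by (meson le_funD order_trans)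
    then show ?thesis by (simp add: linear_neg[OF \<open>linear f\<close>])
  qed
  ultimately show ?thesis by blast
qed

section \<open>The seminorm on the group algebra\<close>

lemma lookup_scaleR:
  "Poly_Mapping.lookup (r *\<^sub>R x) i = r *\<^sub>R Poly_Mapping.lookup x i"
proof -
  have "finite {i. r *\<^sub>R Poly_Mapping.lookup x i \<noteq> 0}"
    by (rule finite_subset[OF _ finite_keys[of x]]) (auto simp: in_keys_iff)
  then show ?thesis
    by (simp add: scaleR_poly_mapping_def Abs_poly_mapping_inverse)
qed

lemma scaleR_single: "b *\<^sub>R Poly_Mapping.single a c = Poly_Mapping.single a (b *\<^sub>R c)"
  by (rule poly_mapping_eqI) (simp add: lookup_scaleR lookup_single when_def)

lemma scaleR_of_group: "b *\<^sub>R of_group a = Poly_Mapping.single a b"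
  by (simp add: of_group_def scaleR_single)

lemma group_algebra_induct [case_names zero add]:
  assumes "P 0" and add: "\<And>\<gamma> a b. P \<gamma> \<Longrightarrow> P (\<gamma> + b *\<^sub>R of_group a)"
  shows "P (\<gamma> :: 'a \<Rightarrow>\<^sub>0 real)"
proof (induction \<gamma> rule: update_induct)
  case (update f a b)
  \<comment> \<open>The key \<open>a\<close> is outside the support of \<open>f\<close>, so
    overwriting the coefficient amounts to adding a term.\<close>
  have "Poly_Mapping.update a b f = f + b *\<^sub>R of_group a"
    using update(1)
    by (intro poly_mapping_eqI)
      (auto simp: lookup_update lookup_add scaleR_of_group lookup_single when_def in_keys_iff)
  then show ?case using add update by metis
qed fact

text \<open>Reduces the compatibility of scalars with convolution to associativity of the
  convolution product.\<close>

lemma scaleR_conv_mult: "r *\<^sub>R \<gamma> = Poly_Mapping.single 0 r * (\<gamma> :: 'a::monoid_add \<Rightarrow>\<^sub>0 real)"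
  by (induction \<gamma> rule: group_algebra_induct)
    (simp_all add: scaleR_add_right distrib_left scaleR_of_group mult_single scaleR_single)

lemma scaleR_mult: "(r *\<^sub>R \<gamma>) * \<delta> = r *\<^sub>R (\<gamma> * \<delta>)" for \<gamma> :: "'a::monoid_add \<Rightarrow>\<^sub>0 real"
  by (simp add: scaleR_conv_mult mult.assoc)

lemma of_group_mult: "of_group x * of_group y = of_group (x + y)"
  by (simp add: of_group_def mult_single)

text \<open>The augmentation of the group algebra. Its kernel is spanned by differences of group
  elements, so there \<open>AE_norm\<close> is an infimum over a non-empty set.\<close>

definition coeff_sum :: "('a \<Rightarrow>\<^sub>0 real) \<Rightarrow> real" where
  "coeff_sum \<gamma> = (\<Sum>x. Poly_Mapping.lookup \<gamma> x)"

lemma linear_coeff_sum: "linear coeff_sum"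
proof (rule linearI)
  fix \<gamma> \<delta> :: "'a \<Rightarrow>\<^sub>0 real" and r :: real
  show "coeff_sum (\<gamma> + \<delta>) = coeff_sum \<gamma> + coeff_sum \<delta>"
    by (simp add: coeff_sum_def lookup_add Sum_any.distrib)
  show "coeff_sum (r *\<^sub>R \<gamma>) = r *\<^sub>R coeff_sum \<gamma>"
    by (simp add: coeff_sum_def lookup_scaleR Sum_any_right_distrib)
qed

lemma coeff_sum_of_group: "coeff_sum (of_group x) = 1"
  by (simp add: coeff_sum_def of_group_def lookup_single)

lemma coeff_sum_mult_of_group: "coeff_sum (\<gamma> * of_group g) = coeff_sum \<gamma>"
  by (induction \<gamma> rule: group_algebra_induct)
    (simp_all add: linear_0 linear_add linear_scale linear_coeff_sum distrib_right scaleR_mult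
      coeff_sum_of_group of_group_mult)

section \<open>Costs of decompositions into differences of group elements\<close>

definition AE_costs :: "('a \<Rightarrow> 'a \<Rightarrow> real) \<Rightarrow> ('a \<Rightarrow>\<^sub>0 real) \<Rightarrow> real set" where
  "AE_costs d \<gamma> =
     {\<Sum>i<n. \<bar>a i\<bar> * d (g i) (f i) | (n::nat) (a :: nat \<Rightarrow> real) (g :: nat \<Rightarrow> 'a) (f :: nat \<Rightarrow> 'a).
        \<gamma> = (\<Sum>i<n. a i *\<^sub>R (of_group (g i) - of_group (f i)))}"

lemma AE_norm_eq_Inf: "AE_norm d \<gamma> = Inf (AE_costs d \<gamma>)"
  by (simp add: AE_norm_def AE_costs_def)

lemma AE_costs_elem: "\<bar>b\<bar> * d x y \<in> AE_costs d (b *\<^sub>R (of_group x - of_group y))"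
  unfolding AE_costs_def mem_Collect_eq
  by (rule exI[of _ 1], rule exI[of _ "\<lambda>_. b"], rule exI[of _ "\<lambda>_. x"], rule exI[of _ "\<lambda>_. y"]) simp

lemma sum_lessThan_append:
  fixes F G :: "nat \<Rightarrow> 'b::comm_monoid_add"
  shows "(\<Sum>i<n + m. if i < n then F i else G (i - n)) = (\<Sum>i<n. F i) + (\<Sum>i<m. G i)"
  by (induction m) (simp_all add: add.assoc)

text \<open>Concatenating two decompositions adds their costs; subadditivity of the norm follows by
  taking infima.\<close>

lemma AE_costs_add:
  assumes "c \<in> AE_costs d \<gamma>" "c' \<in> AE_costs d \<gamma>'"
  shows "c + c' \<in> AE_costs d (\<gamma> + \<gamma>')"
proof -
  obtain n n' :: nat and a g f a' g' f' where
    1: "c = (\<Sum>i<n. \<bar>a i\<bar> * d (g i) (f i))" "\<gamma> = (\<Sum>i<n. a i *\<^sub>R (of_group (g i) - of_group (f i)))" and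
    2: "c' = (\<Sum>i<n'. \<bar>a' i\<bar> * d (g' i) (f' i))" "\<gamma>' = (\<Sum>i<n'. a' i *\<^sub>R (of_group (g' i) - of_group (f' i)))"
    using assms unfolding AE_costs_def by blast
  define A where "A i = (if i < n then a i else a' (i - n))" for i
  define G where "G i = (if i < n then g i else g' (i - n))" for i
  define F where "F i = (if i < n then f i else f' (i - n))" for i
  have "c + c' = (\<Sum>i<n + n'. \<bar>A i\<bar> * d (G i) (F i))"
    unfolding 1 2 sum_lessThan_append[symmetric]
    by (rule sum.cong) (auto simp: A_def G_def F_def)
  moreover have "\<gamma> + \<gamma>' = (\<Sum>i<n + n'. A i *\<^sub>R (of_group (G i) - of_group (F i)))"
    unfolding 1 2 sum_lessThan_append[symmetric]
    by (rule sum.cong) (auto simp: A_def G_def F_def)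
  ultimately show ?thesis
    unfolding AE_costs_def by blast
qed

lemma AE_costs_scale:
  assumes "c \<in> AE_costs d \<gamma>"
  shows "\<bar>t\<bar> * c \<in> AE_costs d (t *\<^sub>R \<gamma>)"
proof -
  obtain n a g f where
    1: "c = (\<Sum>i<n. \<bar>a i\<bar> * d (g i) (f i))" "\<gamma> = (\<Sum>i<n::nat. a i *\<^sub>R (of_group (g i) - of_group (f i)))"
    using assms unfolding AE_costs_def by auto
  have "\<bar>t\<bar> * c = (\<Sum>i<n. \<bar>t * a i\<bar> * d (g i) (f i))"
    unfolding 1 by (simp add: sum_distrib_left abs_mult mult.assoc)
  moreover have "t *\<^sub>R \<gamma> = (\<Sum>i<n. (t * a i) *\<^sub>R (of_group (g i) - of_group (f i)))"
    unfolding 1 by (simp add: scaleR_sum_right)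
  ultimately show ?thesis
    unfolding AE_costs_def by (intro CollectI exI[of _ n] exI[of _ "\<lambda>i. t * a i"]) blast
qed

lemma AE_costs_nonneg: "ecart d \<Longrightarrow> c \<in> AE_costs d \<gamma> \<Longrightarrow> 0 \<le> c"
  by (auto simp: AE_costs_def ecart_def intro!: sum_nonneg)

lemma AE_norm_le: "ecart d \<Longrightarrow> c \<in> AE_costs d \<gamma> \<Longrightarrow> AE_norm d \<gamma> \<le> c"
  unfolding AE_norm_eq_Inf by (intro cInf_lower bdd_belowI[of _ 0]) (auto dest: AE_costs_nonneg)

text \<open>
  Normalising the coefficient sum extends \<^const>\<open>AE_norm\<close> from the hyperplane of elements with
  coefficient sum 0 to a seminorm on the group algebra. Outside this hyperplane \<^const>\<open>AE_norm\<close> is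
  the junk value \<open>Inf {}\<close>.
\<close>

definition AE_seminorm :: "('a::zero \<Rightarrow> 'a \<Rightarrow> real) \<Rightarrow> ('a \<Rightarrow>\<^sub>0 real) \<Rightarrow> real" where
  "AE_seminorm d \<gamma> = AE_norm d (\<gamma> - coeff_sum \<gamma> *\<^sub>R of_group 0)"

lemma linear_normalise: "linear (\<lambda>\<gamma>. \<gamma> - coeff_sum \<gamma> *\<^sub>R of_group x)"
  by (rule linearI) (simp_all add: linear_add linear_scale linear_coeff_sum algebra_simps)

text \<open>Normalising replaces each term \<open>b *\<^sub>R of_group a\<close> by
  \<open>b *\<^sub>R (of_group a - of_group x)\<close>, which yields an explicit decomposition. This
  keeps the infima below from being taken over the empty set.\<close>

lemma AE_costs_normalise_nonempty: "AE_costs d (\<gamma> - coeff_sum \<gamma> *\<^sub>R of_group x) \<noteq> {}"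
proof (induction \<gamma> rule: group_algebra_induct)
  case zero
  show ?case
    using AE_costs_elem[of 0 d x x] by (auto simp: linear_0 linear_coeff_sum)
next
  case (add \<gamma> a b)
  have "\<gamma> + b *\<^sub>R of_group a - coeff_sum (\<gamma> + b *\<^sub>R of_group a) *\<^sub>R of_group x =
      (\<gamma> - coeff_sum \<gamma> *\<^sub>R of_group x) + b *\<^sub>R (of_group a - of_group x)"
    by (simp add: linear_add linear_scale linear_coeff_sum coeff_sum_of_group algebra_simps)
  then show ?case
    using add AE_costs_add[OF _ AE_costs_elem[of b d a x]] by (metis all_not_in_conv)
qed

lemma AE_seminorm_nonneg: "ecart d \<Longrightarrow> 0 \<le> AE_seminorm d \<gamma>"
  unfolding AE_seminorm_def AE_norm_eq_Inf
  by (intro cInf_greatest AE_costs_normalise_nonempty) (auto dest: AE_costs_nonneg)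

text \<open>Negative \<open>t\<close> is included because \<open>t = -1\<close> gives the symmetry
  of the seminorm.\<close>

lemma AE_seminorm_scale_le:
  assumes d: "ecart d" and "t \<noteq> 0"
  shows "AE_seminorm d (t *\<^sub>R \<gamma>) \<le> \<bar>t\<bar> * AE_seminorm d \<gamma>"
  using assms(2)
  unfolding AE_seminorm_def linear_scale[OF linear_normalise] AE_norm_eq_Inf[of d "\<gamma> - _"]
  by (intro le_mult_cInf AE_norm_le[OF d] AE_costs_scale AE_costs_normalise_nonempty) auto

lemma sublinear_AE_seminorm:
  assumes d: "ecart d"
  shows "sublinear (AE_seminorm d)"
proof (rule sublinearI)
  show "AE_seminorm d (\<gamma> + \<delta>) \<le> AE_seminorm d \<gamma> + AE_seminorm d \<delta>" for \<gamma> \<delta>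
    unfolding AE_seminorm_def linear_add[OF linear_normalise]
      AE_norm_eq_Inf[of d "\<gamma> - _"] AE_norm_eq_Inf[of d "\<delta> - _"]
    by (intro le_cInf_add AE_norm_le[OF d] AE_costs_add AE_costs_normalise_nonempty) auto
  show "0 \<le> AE_seminorm d 0" by (rule AE_seminorm_nonneg[OF d])
  show "AE_seminorm d (t *\<^sub>R \<gamma>) \<le> t * AE_seminorm d \<gamma>" if "0 < t" for t \<gamma>
    using AE_seminorm_scale_le[OF d, of t \<gamma>] that by simp
qed

lemma AE_seminorm_minus_le: "ecart d \<Longrightarrow> AE_seminorm d (- \<gamma>) \<le> AE_seminorm d \<gamma>"
  using AE_seminorm_scale_le[of d "-1" \<gamma>] by simp

lemma AE_seminorm_eq_AE_norm: "coeff_sum \<gamma> = 0 \<Longrightarrow> AE_seminorm d \<gamma> = AE_norm d \<gamma>"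
  by (simp add: AE_seminorm_def)

lemma AE_seminorm_of_group_diff_le:
  assumes "ecart d"
  shows "AE_seminorm d (of_group x - of_group y) \<le> d x y"
  using AE_norm_le[OF assms AE_costs_elem[of 1 d x y]]
  by (simp add: AE_seminorm_eq_AE_norm linear_diff linear_coeff_sum coeff_sum_of_group)

text \<open>Write \<beta>g - \<beta>f as (\<beta>g - \<beta>) - (\<beta>f - \<beta>). Translation
  preserves the coefficient sum, so norm and seminorm agree on these differences, and it suffices to
  control one displacement for each group element.\<close>

lemma AE_norm_translates_le:
  fixes d :: "'a::monoid_add \<Rightarrow> 'a \<Rightarrow> real"
  assumes d: "ecart d"
  shows "AE_norm d (\<beta> * of_group g - \<beta> * of_group f) \<le>
    AE_seminorm d (\<beta> * of_group g - \<beta>) + AE_seminorm d (\<beta> * of_group f - \<beta>)"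
proof -
  have "AE_norm d (\<beta> * of_group g - \<beta> * of_group f) =
      AE_seminorm d ((\<beta> * of_group g - \<beta>) + - (\<beta> * of_group f - \<beta>))"
    by (simp add: AE_seminorm_eq_AE_norm linear_diff linear_coeff_sum coeff_sum_mult_of_group)
  also have "\<dots> \<le> AE_seminorm d (\<beta> * of_group g - \<beta>) + AE_seminorm d (- (\<beta> * of_group f - \<beta>))"
    by (rule sublinear_add[OF sublinear_AE_seminorm[OF d]])
  finally show ?thesis
    using AE_seminorm_minus_le[OF d, of "\<beta> * of_group f - \<beta>"] by linarith
qed

lemma finite_displacements: "finite E \<Longrightarrow> finite {F g f | g f. g \<in> E \<and> f \<in> E}"
  by (rule finite_subset[of _ "(\<lambda>(g, f). F g f) ` (E \<times> E)"]) auto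

lemma max_displacement_nonneg: "finite E \<Longrightarrow> 0 \<le> max_displacement d E \<beta>"
  unfolding max_displacement_def by (intro Max_ge) (auto simp: finite_displacements)

text \<open>The factor 2 arises because each of the two displacements bounding a pair is estimated
  by the whole sum.\<close>

lemma max_displacement_le:
  assumes d: "ecart d" and E: "finite E"
  shows "max_displacement d E \<beta> \<le> 2 * (\<Sum>g\<in>E. AE_seminorm d (\<beta> * of_group g - \<beta>))"
proof -
  define S where "S = (\<Sum>g\<in>E. AE_seminorm d (\<beta> * of_group g - \<beta>))"
  have "AE_seminorm d (\<beta> * of_group g - \<beta>) \<le> S" if "g \<in> E" for g
    unfolding S_def using that E by (intro member_le_sum) (auto simp: AE_seminorm_nonneg[OF d])
  then have "AE_norm d (\<beta> * of_group g - \<beta> * of_group f) \<le> 2 * S" if "g \<in> E" "f \<in> E" for g f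
    using AE_norm_translates_le[OF d, of \<beta> g f] that by (smt (verit))
  moreover have "0 \<le> S" unfolding S_def by (intro sum_nonneg AE_seminorm_nonneg[OF d])
  ultimately show ?thesis
    unfolding max_displacement_def S_def[symmetric] using E
    by (subst Max_le_iff) (auto simp: finite_displacements)
qed

section \<open>Means and Lipschitz functions\<close>

lemma LUCB_add:
  assumes "\<phi> \<in> LUCB" "\<psi> \<in> LUCB"
  shows "(\<lambda>x. \<phi> x + \<psi> x) \<in> LUCB"
  using assms by (auto simp: LUCB_def intro!: bounded_plus_comp uniform_limit_intros)

lemma LUCB_const: "(\<lambda>x. c) \<in> LUCB"
  by (auto simp: LUCB_def intro!: uniform_limit_intros)

lemma mean_add: "mean_on_LUCB m \<Longrightarrow> \<phi> \<in> LUCB \<Longrightarrow> \<psi> \<in> LUCB \<Longrightarrow> m (\<lambda>x. \<phi> x + \<psi> x) = m \<phi> + m \<psi>"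
  and mean_nonneg: "mean_on_LUCB m \<Longrightarrow> \<phi> \<in> LUCB \<Longrightarrow> (\<And>x. 0 \<le> \<phi> x) \<Longrightarrow> 0 \<le> m \<phi>"
  by (auto simp: mean_on_LUCB_def)

lemma mean_scale: "mean_on_LUCB m \<Longrightarrow> \<phi> \<in> LUCB \<Longrightarrow> m (\<lambda>x. c * \<phi> x) = c * m \<phi>"
  by (auto simp: mean_on_LUCB_def)

lemma LUCB_scale:
  assumes "\<phi> \<in> LUCB"
  shows "(\<lambda>x. c * \<phi> x) \<in> LUCB"
  using assms bounded_scaling[of "range \<phi>" c]
  by (auto simp: LUCB_def image_image intro!: bounded_linear_uniform_limit_intros)

lemma mean_const:
  assumes "mean_on_LUCB m"
  shows "m (\<lambda>x. c) = c"
  using mean_scale[OF assms LUCB_const[of 1], of c] assms by (simp add: mean_on_LUCB_def)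

lemma mean_ge:
  assumes m: "mean_on_LUCB m" and \<phi>: "\<phi> \<in> LUCB" and ge: "\<And>x. c \<le> \<phi> x"
  shows "c \<le> m \<phi>"
proof -
  have "0 \<le> m (\<lambda>x. \<phi> x + - c)"
    using ge by (intro mean_nonneg[OF m] LUCB_add \<phi> LUCB_const) simp
  then show ?thesis by (simp only: mean_add[OF m \<phi> LUCB_const] mean_const[OF m])
qed

lemma mean_abs_le:
  assumes m: "mean_on_LUCB m" and \<phi>: "\<phi> \<in> LUCB" and le: "\<And>x. \<bar>\<phi> x\<bar> \<le> c"
  shows "\<bar>m \<phi>\<bar> \<le> c"
proof -
  have "- c \<le> m \<phi>" using le by (intro mean_ge[OF m \<phi>]) (simp add: abs_le_iff minus_le_iff)
  moreover have "- c \<le> m (\<lambda>x. -1 * \<phi> x)"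
    using le by (intro mean_ge[OF m LUCB_scale[OF \<phi>]]) (simp add: abs_le_iff)
  ultimately show ?thesis by (simp only: mean_scale[OF m \<phi>])
qed

text \<open>Membership and value are proved together, since additivity of the mean applies only to
  functions already known to lie in \<open>LUCB\<close>.\<close>

lemma mean_sum:
  assumes m: "mean_on_LUCB m" and "\<And>i. i \<in> I \<Longrightarrow> \<phi> i \<in> LUCB"
  shows "(\<lambda>x. \<Sum>i\<in>I. \<phi> i x) \<in> LUCB \<and> m (\<lambda>x. \<Sum>i\<in>I. \<phi> i x) = (\<Sum>i\<in>I. m (\<phi> i))"
  using assms(2)
  by (induction I rule: infinite_finite_induct)
    (auto simp: LUCB_const mean_const[OF m] mean_add[OF m] intro!: LUCB_add)

section \<open>Displacements of Lipschitz functions and their means\<close>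

lemma tendsto_ecart:
  fixes d :: "'a::topological_space \<Rightarrow> 'a \<Rightarrow> real"
  assumes "ecart d" "continuous_on UNIV (\<lambda>p. d (fst p) (snd p))" "continuous_on UNIV f"
  shows "((\<lambda>h. d (f h) (f g)) \<longlongrightarrow> 0) (at g)"
proof -
  have "continuous_on UNIV (\<lambda>h. (f h, f g))"
    using assms(3) by (intro continuous_intros)
  then have "continuous_on UNIV (\<lambda>h. d (f h) (f g))"
    using continuous_on_compose2[OF assms(2)] by fastforce
  then have "((\<lambda>h. d (f h) (f g)) \<longlongrightarrow> d (f g) (f g)) (at g)"
    by (simp add: continuous_on)
  then show ?thesis
    using assms(1) by (simp add: ecart_def)
qed

text \<open>Left invariance removes \<open>x\<close> from both estimates: d(xu, x) = d(u, 1) gives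
  boundedness, while d(xhu, xgu) = d(hu, gu) and d(xh, xg) = d(h, g) make the continuity uniform in
  \<open>x\<close>.\<close>

lemma Lipschitz_displacement_in_LUCB:
  fixes d :: "'a::topological_group_add \<Rightarrow> 'a \<Rightarrow> real"
  assumes d: "ecart d" "continuous_on UNIV (\<lambda>p. d (fst p) (snd p))" "left_invariant d"
    and \<phi>: "\<And>x y. \<bar>\<phi> x - \<phi> y\<bar> \<le> d x y"
  shows "(\<lambda>x. \<phi> (x + u) - \<phi> x) \<in> LUCB"
proof -
  have inv: "d (g + x) (g + y) = d x y" for g x y
    using d(3) by (simp add: left_invariant_def)
  have "\<bar>\<phi> (x + u) - \<phi> x\<bar> \<le> d u 0" for x
    using \<phi>[of "x + u" "x + 0"] inv[of x u 0] by simp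
  then have "bounded (range (\<lambda>x. \<phi> (x + u) - \<phi> x))"
    by (auto simp: bounded_iff)
  moreover have "uniform_limit UNIV (\<lambda>h x. \<phi> (x + h + u) - \<phi> (x + h))
      (\<lambda>x. \<phi> (x + g + u) - \<phi> (x + g)) (at g)" for g
  proof (rule uniform_limitI)
    fix e :: real assume e: "0 < e"
    have "((\<lambda>h. d (h + u) (g + u) + d h g) \<longlongrightarrow> 0 + 0) (at g)"
      by (intro tendsto_add tendsto_ecart[OF d(1,2), of "\<lambda>h. h + u"] tendsto_ecart[OF d(1,2), of "\<lambda>h. h"]
          continuous_intros)
    then have "((\<lambda>h. d (h + u) (g + u) + d h g) \<longlongrightarrow> 0) (at g)" by simp
    then have "\<forall>\<^sub>F h in at g. d (h + u) (g + u) + d h g < e"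
      using e by (rule order_tendstoD)
    then show "\<forall>\<^sub>F h in at g. \<forall>x\<in>UNIV. dist (\<phi> (x + h + u) - \<phi> (x + h)) (\<phi> (x + g + u) - \<phi> (x + g)) < e"
    proof eventually_elim
      case (elim h)
      have "dist (\<phi> (x + h + u) - \<phi> (x + h)) (\<phi> (x + g + u) - \<phi> (x + g)) \<le>
          d (h + u) (g + u) + d h g" for x
        using \<phi>[of "x + (h + u)" "x + (g + u)"] \<phi>[of "x + h" "x + g"]
        unfolding inv dist_real_def add.assoc by linarith
      with elim show ?case by (auto intro: le_less_trans)
    qed
  qed
  ultimately show ?thesis by (simp add: LUCB_def)
qed

text \<open>A Lipschitz \<open>\<phi>\<close> may be unbounded, so invariance cannot be applied to
  \<open>\<phi>\<close> itself. Instead the displacement by uv splits into the displacement by u and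
  the translate by u of the displacement by v, which makes its mean a homomorphism in the group
  element.\<close>

lemma mean_displacement_zero:
  fixes d :: "'a::topological_group_add \<Rightarrow> 'a \<Rightarrow> real"
  assumes m: "mean_on_LUCB m" and m_inv: "\<And>g \<phi>. \<phi> \<in> LUCB \<Longrightarrow> m (\<lambda>x. \<phi> (x + g)) = m \<phi>"
    and d: "ecart d" "continuous_on UNIV (\<lambda>p. d (fst p) (snd p))" "left_invariant d"
    and hom: "(\<exists>C. \<forall>x y. d x y \<le> C) \<or>
         (\<forall>h :: 'a \<Rightarrow> real. continuous_on UNIV h \<and> (\<forall>x y. h (x + y) = h x + h y)
            \<longrightarrow> (\<forall>x. h x = 0))"
    and \<phi>: "\<And>x y. \<bar>\<phi> x - \<phi> y\<bar> \<le> d x y"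
  shows "m (\<lambda>x. \<phi> (x + u) - \<phi> x) = 0"
proof -
  have inv: "d (g + x) (g + y) = d x y" for g x y
    using d(3) by (simp add: left_invariant_def)
  note LUCB = Lipschitz_displacement_in_LUCB[OF d \<phi>]
  define h where "h u = m (\<lambda>x. \<phi> (x + u) - \<phi> x)" for u
  have add: "h (u + v) = h u + h v" for u v
  proof -
    have inLUCB: "(\<lambda>x. \<phi> (x + u + v) - \<phi> (x + u)) \<in> LUCB"
      using LUCB_add[OF LUCB[of "u + v"] LUCB_scale[OF LUCB[of u], of "-1"]]
      by (simp add: add.assoc)
    have "h (u + v) = m (\<lambda>x. (\<phi> (x + u + v) - \<phi> (x + u)) + (\<phi> (x + u) - \<phi> x))"
      by (simp add: h_def add.assoc)
    also have "\<dots> = m (\<lambda>x. \<phi> (x + u + v) - \<phi> (x + u)) + h u"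
      unfolding h_def by (rule mean_add[OF m inLUCB LUCB])
    also have "m (\<lambda>x. \<phi> (x + u + v) - \<phi> (x + u)) = h v"
      unfolding h_def by (rule m_inv[OF LUCB])
    finally show ?thesis by simp
  qed
  have le: "\<bar>h u\<bar> \<le> d u 0" for u
    unfolding h_def
  proof (rule mean_abs_le[OF m LUCB])
    show "\<bar>\<phi> (x + u) - \<phi> x\<bar> \<le> d u 0" for x
      using \<phi>[of "x + u" "x + 0"] inv[of x u 0] by simp
  qed
  have "\<forall>u. h u = 0"
    using hom
  proof
    assume "\<exists>C. \<forall>x y. d x y \<le> C"
    then obtain C where C: "\<And>x y. d x y \<le> C" by blast
    show ?thesis
    proof (rule allI, rule ccontr)
      fix u assume u: "h u \<noteq> 0"
      \<comment> \<open>A non-zero homomorphism to the reals takes arbitrarily large values on the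
        powers of \<open>u\<close>, whereas
        \<open>\<bar>h v\<bar> \<le> d v 0 \<le> C\<close>.\<close>
      have mult: "\<exists>v. h v = real n * h u" for n
      proof (induction n)
        case 0
        have "h 0 = 0" using add[of 0 0] by simp
        then show ?case by auto
      next
        case (Suc n)
        then obtain v where "h v = real n * h u" by blast
        then have "h (v + u) = real (Suc n) * h u" by (simp add: add algebra_simps)
        then show ?case by blast
      qed
      obtain n where n: "C < real n * \<bar>h u\<bar>"
        using u reals_Archimedean3[of "\<bar>h u\<bar>"] by auto
      obtain v where "h v = real n * h u" using mult by blast
      then have "\<bar>h v\<bar> = real n * \<bar>h u\<bar>" by (simp add: abs_mult)
      with n le[of v] C[of v 0] show False by linarith
    qed
  next
    assume hom: "\<forall>h :: 'a \<Rightarrow> real. continuous_on UNIV h \<and> (\<forall>x y. h (x + y) = h x + h y)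
            \<longrightarrow> (\<forall>x. h x = 0)"
    \<comment> \<open>Additivity and left invariance upgrade the bound at the identity to
      \<open>\<bar>h u - h g\<bar> \<le> d u g\<close>, whence continuity everywhere.\<close>
    have "(h \<longlongrightarrow> h g) (at g)" for g
    proof (rule LIM_zero_cancel, rule Lim_null_comparison)
      have "norm (h u - h g) \<le> d u g" for u
      proof -
        have "h u = h g + h (- g + u)" using add[of g "- g + u"] by (simp add: add.assoc[symmetric])
        then show ?thesis using le[of "- g + u"] inv[of g "- g + u" 0] by (simp add: add.assoc[symmetric])
      qed
      then show "\<forall>\<^sub>F u in at g. norm (h u - h g) \<le> d u g" by simp
      show "((\<lambda>u. d u g) \<longlongrightarrow> 0) (at g)"
        by (rule tendsto_ecart[OF d(1,2) continuous_on_id])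
    qed
    then have "continuous_on UNIV h" by (simp add: continuous_on)
    with hom add show ?thesis by blast
  qed
  then show ?thesis by (simp add: h_def)
qed

section \<open>The separation argument\<close>

theorem theorem1p1:
  fixes d :: "'a::topological_group_add \<Rightarrow> 'a \<Rightarrow> real"
  assumes "amenable TYPE('a)"
    and "ecart d"
    and "continuous_on UNIV (\<lambda>p. d (fst p) (snd p))"
    and "left_invariant d"
    and "(\<exists>C. \<forall>x y. d x y \<le> C) \<or>
         (\<forall>h :: 'a \<Rightarrow> real. continuous_on UNIV h \<and> (\<forall>x y. h (x + y) = h x + h y)
            \<longrightarrow> (\<forall>x. h x = 0))"
  shows "\<forall>E. finite E \<longrightarrow> (INF \<beta>\<in>Delta. max_displacement d E \<beta>) = 0"
proof (intro allI impI)
  fix E :: "'a set"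
  assume E: "finite E"
  note d = assms(2-4)
  define \<epsilon> where "\<epsilon> = (INF \<beta>\<in>Delta. max_displacement d E \<beta>)"
  have of_group_in: "of_group x \<in> Delta" for x :: 'a
    unfolding Delta_def by (intro hull_inc) simp
  then have ne: "(Delta :: ('a \<Rightarrow>\<^sub>0 real) set) \<noteq> {}" by blast
  have "0 \<le> \<epsilon>"
    unfolding \<epsilon>_def using ne by (intro cINF_greatest max_displacement_nonneg E)
  moreover have "\<not> 0 < \<epsilon>"
  proof
    assume "0 < \<epsilon>"
    have disp: "\<epsilon> \<le> max_displacement d E \<beta>" if "\<beta> \<in> Delta" for \<beta>
      unfolding \<epsilon>_def using that
      by (intro cINF_lower bdd_belowI2[where m = 0] max_displacement_nonneg E)
    \<comment> \<open>Tuples indexed by \<open>E\<close> are encoded as finitely supported functions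
      from the group to its group algebra, so that they form a real vector space; \<open>p\<close>
      sees only the coordinates in \<open>E\<close>.\<close>
    define p where
      "p w = (\<Sum>g\<in>E. AE_seminorm d (Poly_Mapping.lookup w g))" for w :: "'a \<Rightarrow>\<^sub>0 ('a \<Rightarrow>\<^sub>0 real)"
    define \<Lambda> where
      "\<Lambda> \<beta> = (\<Sum>g\<in>E. Poly_Mapping.single g (\<beta> * of_group g - \<beta>))" for \<beta> :: "'a \<Rightarrow>\<^sub>0 real"
    have N: "sublinear (AE_seminorm d)" by (rule sublinear_AE_seminorm[OF d(1)])
    have p: "sublinear p"
      by (auto simp: sublinear_def p_def lookup_add lookup_scaleR sum_distrib_left
          sublinear_scale[OF N] simp flip: sum.distrib intro!: sum_mono sublinear_add[OF N])
    have lookup_\<Lambda>: "Poly_Mapping.lookup (\<Lambda> \<beta>) g = \<beta> * of_group g - \<beta>" if "g \<in> E" for g \<beta>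
      using that E by (simp add: \<Lambda>_def lookup_sum lookup_single when_def)
    have "linear \<Lambda>"
      by (rule linearI)
        (simp_all add: \<Lambda>_def distrib_right scaleR_mult scaleR_sum_right scaleR_single
          scaleR_diff_right add_diff_add single_add flip: sum.distrib)
    then have "convex (\<Lambda> ` Delta)"
      by (intro convex_linear_image) (simp_all add: Delta_def)
    \<comment> \<open>Half of \<open>\<epsilon>\<close> compensates for the factor 2 in
      \<open>max_displacement_le\<close>.\<close>
    moreover have "\<epsilon> / 2 \<le> p c" if c: "c \<in> \<Lambda> ` Delta" for c
    proof -
      obtain \<beta> where "\<beta> \<in> Delta" "c = \<Lambda> \<beta>" using c by blast
      then show ?thesis
        using disp[of \<beta>] max_displacement_le[OF d(1) E, of \<beta>] by (simp add: p_def lookup_\<Lambda>)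
    qed
    ultimately obtain F where F: "linear F" "\<And>w. F w \<le> p w" "\<And>c. c \<in> \<Lambda> ` Delta \<Longrightarrow> \<epsilon> / 2 \<le> F c"
      using Hahn_Banach_separation[OF p, of "\<Lambda> ` Delta" "\<epsilon> / 2"] ne by auto
    define \<phi> where "\<phi> g x = F (Poly_Mapping.single g (of_group x))" for g x
    have le: "\<phi> g x - \<phi> g y \<le> d x y" if "g \<in> E" for g x y
    proof -
      have "\<phi> g x - \<phi> g y = F (Poly_Mapping.single g (of_group x - of_group y))"
        by (simp add: \<phi>_def single_diff linear_diff[OF F(1)])
      also have "\<dots> \<le> p (Poly_Mapping.single g (of_group x - of_group y))" by (rule F(2))
      \<comment> \<open>On a tuple supported at \<open>g\<close> only one summand of
        \<open>p\<close> survives, so domination by \<open>p\<close> becomes the Lipschitz condition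
        for \<open>d\<close>.\<close>
      also have "\<dots> = (\<Sum>g'\<in>E. if g' = g then AE_seminorm d (of_group x - of_group y) else 0)"
        unfolding p_def by (rule sum.cong) (auto simp: lookup_single when_def sublinear_zero[OF N])
      also have "\<dots> \<le> d x y"
        using E that AE_seminorm_of_group_diff_le[OF d(1)] by simp
      finally show ?thesis .
    qed
    have Lip: "\<bar>\<phi> g x - \<phi> g y\<bar> \<le> d x y" if "g \<in> E" for g x y
      using le[OF that, of x y] le[OF that, of y x] d(1) by (simp add: ecart_def abs_le_iff)
    obtain m where m: "mean_on_LUCB m"
      and m_inv: "\<And>g (\<phi> :: 'a \<Rightarrow> real). \<phi> \<in> LUCB \<Longrightarrow> m (\<lambda>x. \<phi> (x + g)) = m \<phi>"
      using assms(1) unfolding amenable_def by blast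
    have ge: "\<epsilon> / 2 \<le> (\<Sum>g\<in>E. \<phi> g (x + g) - \<phi> g x)" for x
    proof -
      have "F (\<Lambda> (of_group x)) = (\<Sum>g\<in>E. \<phi> g (x + g) - \<phi> g x)"
        by (simp add: \<Lambda>_def \<phi>_def linear_sum[OF F(1)] of_group_mult single_diff linear_diff[OF F(1)])
      then show ?thesis using F(3)[of "\<Lambda> (of_group x)"] of_group_in by simp
    qed
    note LUCB = Lipschitz_displacement_in_LUCB[OF d Lip]
    \<comment> \<open>Averaging preserves the pointwise lower bound, while the mean of each single
      summand is zero.\<close>
    have "\<epsilon> / 2 \<le> m (\<lambda>x. \<Sum>g\<in>E. \<phi> g (x + g) - \<phi> g x)"
      using ge mean_sum[OF m LUCB, of E "\<lambda>g. g" "\<lambda>g. g"] by (intro mean_ge[OF m]) auto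
    also have "\<dots> = (\<Sum>g\<in>E. m (\<lambda>x. \<phi> g (x + g) - \<phi> g x))"
      using mean_sum[OF m LUCB, of E "\<lambda>g. g" "\<lambda>g. g"] by auto
    also have "\<dots> = 0"
      by (intro sum.neutral ballI mean_displacement_zero[OF m m_inv d assms(5) Lip])
    finally show False using \<open>0 < \<epsilon>\<close> by simp
  qed
  ultimately show "(INF \<beta>\<in>Delta. max_displacement d E \<beta>) = 0"
    unfolding \<epsilon>_def by simp
qed

end
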